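(* Let $R$ be a $2$-dimensional Cohen--Macaulay local ring and let $N$ be the nilradical of $R$. If $((g)+N)^{\mathrm{sat}}=(g)+N$ for every $R$-regular element $g\in R$, then $R_{\mathrm{red}}=R/N$ is Cohen--Macaulay.
   Context: Local rings are Noetherian. For an ideal $K$ of a local ring $(R,\mathfrak m)$, the saturation of $K$ is $K^{\mathrm{sat}}=\bigcup_{i\ge 1}(K:_R\mathfrak m^i)$. *)

theory Defs
  imports "HOL-Algebra.Algebra" "HOL-Library.Extended_Nat"
begin

locale noetherian_local_ring = cring + noetherian_ring +
  assumes unique_maximal: "\<exists>!M. maximalideal M R"

definition max_ideal :: "('a, 'b) ring_scheme \<Rightarrow> 'a set" where
  "max_ideal R = (THE M. maximalideal M R)"

text \<open>Lengths of chains of prime ideals count strict inclusions. The zero ring, which has no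
  prime ideals, gets dimension \<open>0\<close> here because \<open>Sup {} = 0\<close> in \<^typ>\<open>enat\<close>; local rings are
  nonzero.\<close>

definition krull_dim :: "('a, 'b) ring_scheme \<Rightarrow> enat" where
  "krull_dim R = Sup {enat n | n. \<exists>P :: nat \<Rightarrow> 'a set.
     (\<forall>i\<le>n. primeideal (P i) R) \<and> (\<forall>i<n. P i \<subset> P (Suc i))}"

text \<open>Regular means non-zerodivisor; units are regular.\<close>

definition regular_element :: "('a, 'b) ring_scheme \<Rightarrow> 'a \<Rightarrow> bool" where
  "regular_element R x \<longleftrightarrow>
     x \<in> carrier R \<and> (\<forall>z\<in>carrier R. x \<otimes>\<^bsub>R\<^esub> z = \<zero>\<^bsub>R\<^esub> \<longrightarrow> z = \<zero>\<^bsub>R\<^esub>)"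

definition regular_sequence :: "('a, 'b) ring_scheme \<Rightarrow> 'a list \<Rightarrow> bool" where
  "regular_sequence R xs \<longleftrightarrow>
     set xs \<subseteq> carrier R \<and>
     (\<forall>i<length xs. let I = Idl\<^bsub>R\<^esub> (set (take i xs)) in
        regular_element (R Quot I) (I +>\<^bsub>R\<^esub> (xs ! i))) \<and>
     Idl\<^bsub>R\<^esub> (set xs) \<noteq> carrier R"

definition depth :: "('a, 'b) ring_scheme \<Rightarrow> enat" where
  "depth R = Sup {enat (length xs) | xs. regular_sequence R xs \<and> set xs \<subseteq> max_ideal R}"

locale cohen_macaulay_local_ring = noetherian_local_ring +
  assumes depth_eq_dim: "depth R = krull_dim R"

definition nilradical :: "('a, 'b) ring_scheme \<Rightarrow> 'a set" where
  "nilradical R = {x \<in> carrier R. \<exists>n::nat. x [^]\<^bsub>R\<^esub> n = \<zero>\<^bsub>R\<^esub>}"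

definition colon_ideal :: "('a, 'b) ring_scheme \<Rightarrow> 'a set \<Rightarrow> 'a set \<Rightarrow> 'a set" where
  "colon_ideal R K J = {x \<in> carrier R. \<forall>j\<in>J. x \<otimes>\<^bsub>R\<^esub> j \<in> K}"

text \<open>The power of the maximal ideal is taken in the multiplicative monoid of ideals, so it is an
  iterated product of ideals.\<close>

definition saturation :: "('a, 'b) ring_scheme \<Rightarrow> 'a set \<Rightarrow> 'a set" where
  "saturation R K =
     (\<Union>i\<in>{1::nat..}. colon_ideal R K (max_ideal R [^]\<^bsub>ideals_set R\<^esub> i))"

end

theory Submission
  imports Defs
begin

text \<open>Let \<open>\<mm>\<close> be the maximal ideal of \<open>R\<close> and let \<open>g, h\<close> be a regular sequence in \<open>\<mm>\<close>, which
  exists because the depth is \<open>2\<close>. The images of \<open>g, h\<close> turn out to be a regular sequence in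
  \<open>R/N\<close>.

  For \<open>g\<close> this holds over any commutative ring: if \<open>gz\<close> is nilpotent, then \<open>g\<^sup>n z\<^sup>n = 0\<close> for some
  \<open>n\<close>, and the factor \<open>g\<^sup>n\<close> can be cancelled (\<open>regular_element_mod_nilradical\<close>).

  For \<open>h\<close> the saturation hypothesis enters. Since \<open>R\<close> has dimension \<open>2\<close>, no prime other than
  \<open>\<mm>\<close> contains both \<open>g\<close> and \<open>h\<close> (\<open>prime_above_full_regular_sequence\<close>): below any prime that
  contains a regular sequence there is a chain of primes of the same length. Hence
  \<open>\<mm>\<^sup>k \<subseteq> (g, h)\<close> for some \<open>k\<close> (\<open>ideal_power_le_ideal\<close>). Put \<open>K = (g) + N\<close>, and suppose
  \<open>hz \<in> K\<close>. As \<open>gz \<in> K\<close> too, \<open>z \<mm>\<^sup>k \<subseteq> z (g, h) \<subseteq> K\<close>, so \<open>z\<close> lies in the saturation of \<open>K\<close>,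
  which is \<open>K\<close>. Thus the given \<open>h\<close> already works
  (\<open>regular_mod_saturated\<close>), and there is no need to find a regular element by prime avoidance.

  So the depth of \<open>R/N\<close> is at least \<open>2\<close>. Chains of primes of \<open>R/N\<close> pull back to \<open>R\<close>, so its
  dimension is at most \<open>2\<close>; and the depth of a Noetherian local ring never exceeds its dimension
  (\<open>depth_le_krull_dim\<close>, again by the chain of primes below a regular sequence). All three
  inequalities are therefore equalities.\<close>

section \<open>Ideals in commutative rings\<close>

lemma (in cring) adjoin_element:
  assumes "ideal I R" "a \<in> carrier R"
  shows "ideal (I <+>\<^bsub>R\<^esub> PIdl a) R" "I \<subseteq> I <+>\<^bsub>R\<^esub> PIdl a" "a \<in> I <+>\<^bsub>R\<^esub> PIdl a"
proof -
  have P: "ideal (PIdl a) R" by (rule cgenideal_ideal[OF assms(2)])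
  show "ideal (I <+>\<^bsub>R\<^esub> PIdl a) R" by (rule add_ideals[OF assms(1) P])
  have sub: "I \<union> PIdl a \<subseteq> I <+>\<^bsub>R\<^esub> PIdl a"
    using genideal_self[of "I \<union> PIdl a"] union_genideal[OF assms(1) P]
      ideal.Icarr[OF assms(1)] ideal.Icarr[OF P] by auto
  then show "I \<subseteq> I <+>\<^bsub>R\<^esub> PIdl a" by blast
  show "a \<in> I <+>\<^bsub>R\<^esub> PIdl a" using sub cgenideal_self[OF assms(2)] by blast
qed

lemma (in cring) adjoin_elementE:
  assumes "s \<in> I <+>\<^bsub>R\<^esub> PIdl a"
  obtains i x where "i \<in> I" "x \<in> carrier R" "s = i \<oplus> x \<otimes> a"
  using assms by (auto simp: set_add_def' cgenideal_def)

text \<open>Expanding \<open>(i + xa)(j + yb)\<close>, every term but \<open>xyab\<close> has a factor in \<open>I\<close>. This is what makes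
  ideals that are maximal for various properties prime.\<close>

lemma (in cring) adjoined_product_mem:
  assumes I: "ideal I R" and a: "a \<in> carrier R" and b: "b \<in> carrier R" and ab: "a \<otimes> b \<in> I"
    and s: "s \<in> I <+>\<^bsub>R\<^esub> PIdl a" and t: "t \<in> I <+>\<^bsub>R\<^esub> PIdl b"
  shows "s \<otimes> t \<in> I"
proof -
  interpret I: ideal I R by (rule I)
  obtain i x where i: "i \<in> I" "x \<in> carrier R" "s = i \<oplus> x \<otimes> a" using s by (rule adjoin_elementE)
  obtain j y where j: "j \<in> I" "y \<in> carrier R" "t = j \<oplus> y \<otimes> b" using t by (rule adjoin_elementE)
  have c: "i \<in> carrier R" "j \<in> carrier R" using i j I.Icarr by auto
  have "s \<otimes> t = i \<otimes> t \<oplus> (x \<otimes> a \<otimes> j \<oplus> x \<otimes> y \<otimes> (a \<otimes> b))"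
    unfolding i(3) j(3) using i(2) j(2) a b c by algebra
  moreover have "t \<in> carrier R" using j c b by simp
  ultimately show ?thesis
    using i j a ab c by (simp add: I.I_l_closed I.I_r_closed)
qed

text \<open>An ideal maximal among those that contain \<open>I\<close> and avoid \<open>S\<close> is prime: if \<open>a\<close> and \<open>b\<close>
  are outside, then adjoining either one makes the ideal meet \<open>S\<close>; were \<open>ab\<close> inside, then the
  product of the two elements of \<open>S\<close> found this way would be inside as well.\<close>

lemma (in cring) exists_prime_disjoint:
  assumes I: "ideal I R" and S: "S \<subseteq> carrier R" "S \<noteq> {}"
    and mult: "\<And>a b. a \<in> S \<Longrightarrow> b \<in> S \<Longrightarrow> a \<otimes> b \<in> S"
    and disj: "I \<inter> S = {}"
  obtains P where "primeideal P R" "I \<subseteq> P" "P \<inter> S = {}"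
proof -
  define A where "A = {J. ideal J R \<and> I \<subseteq> J \<and> J \<inter> S = {}}"
  have "\<exists>M\<in>A. \<forall>J\<in>A. M \<subseteq> J \<longrightarrow> J = M"
  proof (rule subset_Zorn_nonempty)
    show "A \<noteq> {}" using I disj by (auto simp: A_def)
    fix C assume C: "C \<noteq> {}" "subset.chain A C"
    have "subset.chain {J. ideal J R} C" using C(2) by (auto simp: pred_on.chain_def A_def)
    then have "ideal (\<Union>C) R" using chain_Union_is_ideal[of C] C(1) by simp
    then show "\<Union>C \<in> A" using C by (auto simp: pred_on.chain_def A_def subset_eq)
  qed
  then obtain M where M: "ideal M R" "I \<subseteq> M" "M \<inter> S = {}"
    and max: "\<And>J. ideal J R \<Longrightarrow> M \<subseteq> J \<Longrightarrow> J \<inter> S = {} \<Longrightarrow> J = M"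
    by (auto simp: A_def)
  have meets: "\<exists>s\<in>S. s \<in> M <+>\<^bsub>R\<^esub> PIdl a" if "a \<in> carrier R" "a \<notin> M" for a
    using adjoin_element[OF M(1) that(1)] max[of "M <+>\<^bsub>R\<^esub> PIdl a"] that(2) by blast
  have "primeideal M R"
  proof (rule primeidealI[OF M(1) is_cring])
    show "carrier R \<noteq> M" using S M(3) by blast
    fix a b assume ab: "a \<in> carrier R" "b \<in> carrier R" "a \<otimes> b \<in> M"
    show "a \<in> M \<or> b \<in> M"
    proof (rule ccontr)
      assume "\<not> (a \<in> M \<or> b \<in> M)"
      then obtain s t where st: "s \<in> S" "s \<in> M <+>\<^bsub>R\<^esub> PIdl a" "t \<in> S" "t \<in> M <+>\<^bsub>R\<^esub> PIdl b"
        using meets ab by metis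
      then have "s \<otimes> t \<in> M" using adjoined_product_mem[OF M(1) ab] by blast
      then show False using mult st M(3) by blast
    qed
  qed
  then show thesis using that M by blast
qed

text \<open>If \<open>x\<close> is not nilpotent, some prime avoids all powers of \<open>x\<close>. Besides giving that nilpotent
  elements lie in the maximal ideal, this description makes the nilradical an ideal without a
  binomial expansion.\<close>

lemma (in cring) mem_nilradical_iff:
  "x \<in> nilradical R \<longleftrightarrow> x \<in> carrier R \<and> (\<forall>P. primeideal P R \<longrightarrow> x \<in> P)"
proof (intro iffI conjI allI impI)
  assume x: "x \<in> nilradical R"
  then show xc: "x \<in> carrier R" by (simp add: nilradical_def)
  fix P assume "primeideal P R"
  then interpret P: primeideal P R .
  obtain n :: nat where "x [^] n = \<zero>" using x by (auto simp: nilradical_def)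
  moreover have "x [^] k \<in> P \<Longrightarrow> x \<in> P" for k :: nat
  proof (induction k)
    case 0
    then show ?case using P.one_imp_carrier P.I_notcarr by simp
  next
    case (Suc k)
    then show ?case using P.I_prime[of "x [^] k" x] xc by auto
  qed
  ultimately show "x \<in> P" by (metis P.zero_closed)
next
  assume x: "x \<in> carrier R \<and> (\<forall>P. primeideal P R \<longrightarrow> x \<in> P)"
  define S where "S = {x [^] n |n::nat. True}"
  show "x \<in> nilradical R"
  proof (rule ccontr)
    assume "x \<notin> nilradical R"
    then have "{\<zero>} \<inter> S = {}" using x by (auto simp: nilradical_def S_def)
    moreover have "S \<subseteq> carrier R" "S \<noteq> {}" using x by (auto simp: S_def)
    moreover have "a \<otimes> b \<in> S" if ab: "a \<in> S" "b \<in> S" for a b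
    proof -
      obtain m n :: nat where "a = x [^] m" "b = x [^] n" using ab by (auto simp: S_def)
      then have "a \<otimes> b = x [^] (m + n)" using x by (simp add: nat_pow_mult)
      then show ?thesis by (auto simp: S_def)
    qed
    ultimately obtain P where "primeideal P R" "P \<inter> S = {}"
      using exists_prime_disjoint[OF zeroideal, of S] by metis
    moreover have "x [^] (1::nat) \<in> S" unfolding S_def by blast
    then have "x \<in> S" using x by simp
    ultimately show False using x by blast
  qed
qed

lemma (in cring) ideal_nilradical: "ideal (nilradical R) R"
proof -
  have "nilradical R = \<Inter>(insert (carrier R) {P. primeideal P R})"
    using mem_nilradical_iff by blast
  moreover have "ideal (\<Inter>(insert (carrier R) {P. primeideal P R})) R"
    by (rule i_Intersect) (auto intro: oneideal simp: primeideal_def)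
  ultimately show ?thesis by simp
qed

lemma (in noetherian_ring) noetherian_ideal_induct [consumes 1, case_names step]:
  assumes I: "ideal I R"
    and step: "\<And>I. ideal I R \<Longrightarrow> (\<And>J. ideal J R \<Longrightarrow> I \<subset> J \<Longrightarrow> Q J) \<Longrightarrow> Q I"
  shows "Q I"
proof (rule ccontr)
  assume "\<not> Q I"
  define A where "A = {J. ideal J R \<and> \<not> Q J}"
  have "\<exists>M\<in>A. \<forall>J\<in>A. M \<subseteq> J \<longrightarrow> J = M"
  proof (rule subset_Zorn_nonempty)
    show "A \<noteq> {}" using I \<open>\<not> Q I\<close> by (auto simp: A_def)
    fix C assume C: "C \<noteq> {}" "subset.chain A C"
    then have "\<Union>C \<in> C"
      by (intro ideal_chain_is_trivial) (auto simp: pred_on.chain_def A_def)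
    then show "\<Union>C \<in> A" using C(2) by (auto simp: pred_on.chain_def A_def)
  qed
  then show False using step by (smt (verit) A_def mem_Collect_eq psubset_eq)
qed

lemma (in cring) ideal_power_closed:
  "ideal J R \<Longrightarrow> ideal (J [^]\<^bsub>ideals_set R\<^esub> (k::nat)) R"
  using monoid.nat_pow_closed[OF comm_monoid.axioms(1)[OF ideals_set_is_comm_monoid], of J k]
  by (simp add: ideals_set_def)

text \<open>The usual proof takes finitely many generators of \<open>J\<close> and a power of each in \<open>I\<close>. Noetherian
  induction on \<open>I\<close> avoids counting exponents: if \<open>I\<close> is proper and not prime, say \<open>ab \<in> I\<close> with
  \<open>a, b \<notin> I\<close>, then powers of \<open>J\<close> lie in \<open>I + (a)\<close> and in \<open>I + (b)\<close>, and the product of these two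
  ideals lies in \<open>I\<close>. The bound \<open>k \<ge> 1\<close> is there because saturations range over positive
  exponents.\<close>

lemma ideal_power_le_ideal:
  assumes "cring R" "noetherian_ring R" and J: "ideal J R" and I: "ideal I R"
    and "\<And>P. primeideal P R \<Longrightarrow> I \<subseteq> P \<Longrightarrow> J \<subseteq> P"
  shows "\<exists>k\<ge>1::nat. J [^]\<^bsub>ideals_set R\<^esub> k \<subseteq> I"
  using I assms(5)
proof (induction I rule: noetherian_ring.noetherian_ideal_induct[OF assms(2), consumes 1, case_names step])
  case (step I)
  interpret cring R by fact
  interpret M: comm_monoid "ideals_set R" by (rule ideals_set_is_comm_monoid)
  have Jc: "J \<in> carrier (ideals_set R)" using J by (simp add: ideals_set_def)
  consider "primeideal I R" | "I = carrier R"
    | a b where "a \<in> carrier R" "b \<in> carrier R" "a \<otimes>\<^bsub>R\<^esub> b \<in> I" "a \<notin> I" "b \<notin> I"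
    using primeidealI[OF step(1) is_cring] by blast
  then show ?case
  proof cases
    case 1
    then have "J [^]\<^bsub>ideals_set R\<^esub> (1::nat) \<subseteq> I" using step.prems Jc by (simp del: One_nat_def)
    then show ?thesis by blast
  next
    case 2
    then show ?thesis using ideal.Icarr[OF ideal_power_closed[OF J]] by blast
  next
    case (3 a b)
    note Ia = adjoin_element[OF step(1) 3(1)] and Ib = adjoin_element[OF step(1) 3(2)]
    have "\<exists>k\<ge>1::nat. J [^]\<^bsub>ideals_set R\<^esub> k \<subseteq> I <+>\<^bsub>R\<^esub> PIdl\<^bsub>R\<^esub> a"
      by (rule step.IH[OF Ia(1)]) (use Ia 3 step.prems in blast)+
    moreover have "\<exists>k\<ge>1::nat. J [^]\<^bsub>ideals_set R\<^esub> k \<subseteq> I <+>\<^bsub>R\<^esub> PIdl\<^bsub>R\<^esub> b"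
      by (rule step.IH[OF Ib(1)]) (use Ib 3 step.prems in blast)+
    ultimately obtain k l :: nat where kl: "k \<ge> 1"
      "J [^]\<^bsub>ideals_set R\<^esub> k \<subseteq> I <+>\<^bsub>R\<^esub> PIdl\<^bsub>R\<^esub> a" "J [^]\<^bsub>ideals_set R\<^esub> l \<subseteq> I <+>\<^bsub>R\<^esub> PIdl\<^bsub>R\<^esub> b"
      by blast
    have "J [^]\<^bsub>ideals_set R\<^esub> (k + l) = ideal_prod R (J [^]\<^bsub>ideals_set R\<^esub> k) (J [^]\<^bsub>ideals_set R\<^esub> l)"
      using M.nat_pow_mult[OF Jc, of k l] by (simp add: ideals_set_def)
    moreover have "x \<in> I" if "x \<in> ideal_prod R (J [^]\<^bsub>ideals_set R\<^esub> k) (J [^]\<^bsub>ideals_set R\<^esub> l)" for x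
      using that
    proof induction
      case (prod i j)
      then show ?case using adjoined_product_mem[OF step(1) 3(1-3)] kl by blast
    next
      case (sum s t)
      then show ?case using step(1) by (simp add: additive_subgroup.a_closed ideal.axioms(1))
    qed
    ultimately have "J [^]\<^bsub>ideals_set R\<^esub> (k + l) \<subseteq> I" by blast
    then show ?thesis using kl(1) by (metis le_add1 le_trans)
  qed
qed

section \<open>Regular sequences and chains of primes\<close>

lemma (in cring) rcos_eq_ideal_iff:
  assumes "ideal I R" "z \<in> carrier R"
  shows "I +> z = I \<longleftrightarrow> z \<in> I"
  using ideal.rcos_const_imp_mem[OF assms(1)] a_rcos_zero[OF assms(1)] assms(2) by blast

lemma carrier_Quot: "carrier (R Quot I) = (+>\<^bsub>R\<^esub>) I ` carrier R"
  by (auto simp: FactRing_def A_RCOSETS_def')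

lemma zero_Quot: "\<zero>\<^bsub>R Quot I\<^esub> = I"
  by (simp add: FactRing_def)

lemma (in cring) regular_element_Quot_iff:
  assumes I: "ideal I R" and x: "x \<in> carrier R"
  shows "regular_element (R Quot I) (I +> x) \<longleftrightarrow> (\<forall>z\<in>carrier R. x \<otimes> z \<in> I \<longrightarrow> z \<in> I)"
proof -
  have mult: "(I +> x) \<otimes>\<^bsub>R Quot I\<^esub> (I +> z) = I +> (x \<otimes> z)" if "z \<in> carrier R" for z
    using ideal.rcoset_mult_add[OF I x that] by (simp add: FactRing_def)
  show ?thesis
    unfolding regular_element_def carrier_Quot zero_Quot
    using x by (auto simp: mult rcos_eq_ideal_iff[OF I])
qed

text \<open>Quotient rings disappear from the definition, so that one can argue with ideals of \<open>R\<close>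
  alone.\<close>

lemma (in cring) regular_sequence_iff:
  "regular_sequence R xs \<longleftrightarrow>
     set xs \<subseteq> carrier R \<and>
     (\<forall>i<length xs. \<forall>z\<in>carrier R.
        xs ! i \<otimes> z \<in> Idl (set (take i xs)) \<longrightarrow> z \<in> Idl (set (take i xs))) \<and>
     Idl (set xs) \<noteq> carrier R"
proof (cases "set xs \<subseteq> carrier R")
  case True
  have "ideal (Idl (set (take i xs))) R" for i
    by (rule genideal_ideal) (use True set_take_subset[of i xs] in blast)
  then have "regular_element (R Quot Idl (set (take i xs))) (Idl (set (take i xs)) +> xs ! i) \<longleftrightarrow>
      (\<forall>z\<in>carrier R. xs ! i \<otimes> z \<in> Idl (set (take i xs)) \<longrightarrow> z \<in> Idl (set (take i xs)))"
    if "i < length xs" for i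
    using that True by (intro regular_element_Quot_iff) (auto simp: subset_iff)
  then show ?thesis by (simp add: regular_sequence_def Let_def)
qed (simp add: regular_sequence_def)

lemma (in cring) genideal_empty: "Idl {} = {\<zero>}"
  using genideal_minimal[OF zeroideal, of "{}"] genideal_ideal[of "{}"]
  by (auto dest: additive_subgroup.zero_closed[OF ideal.axioms(1)])

lemma (in cring) regular_sequence_pair_iff:
  "regular_sequence R [x, y] \<longleftrightarrow>
     regular_element R x \<and> y \<in> carrier R \<and>
     (\<forall>z\<in>carrier R. y \<otimes> z \<in> PIdl x \<longrightarrow> z \<in> PIdl x) \<and> Idl {x, y} \<noteq> carrier R"
proof (cases "x \<in> carrier R \<and> y \<in> carrier R")
  case True
  have "(\<forall>i<length [x, y]. Q i) \<longleftrightarrow> Q 0 \<and> Q 1" for Q by (simp add: All_less_Suc2)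
  then show ?thesis
    unfolding regular_sequence_iff regular_element_def
    using True by (simp add: genideal_empty cgenideal_eq_genideal)
qed (auto simp: regular_sequence_iff regular_element_def)

lemma (in cring) regular_sequence_snocD:
  assumes "regular_sequence R (xs @ [x])"
  shows "regular_sequence R xs" "x \<in> carrier R"
    and "\<And>z. z \<in> carrier R \<Longrightarrow> x \<otimes> z \<in> Idl (set xs) \<Longrightarrow> z \<in> Idl (set xs)"
proof -
  have c: "set (xs @ [x]) \<subseteq> carrier R" and ne: "Idl (set (xs @ [x])) \<noteq> carrier R"
    and reg: "\<And>i z. i < length (xs @ [x]) \<Longrightarrow> z \<in> carrier R \<Longrightarrow>
      (xs @ [x]) ! i \<otimes> z \<in> Idl (set (take i (xs @ [x]))) \<Longrightarrow> z \<in> Idl (set (take i (xs @ [x])))"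
    using assms unfolding regular_sequence_iff by blast+
  show "x \<in> carrier R" using c by simp
  show "z \<in> Idl (set xs)" if "z \<in> carrier R" "x \<otimes> z \<in> Idl (set xs)" for z
    using reg[of "length xs" z] that by simp
  have "Idl (set xs) \<subseteq> Idl (set (xs @ [x]))" using c by (intro subset_Idl_subset) auto
  moreover have "Idl (set (xs @ [x])) \<subseteq> carrier R"
    using ideal.Icarr[OF genideal_ideal[OF c]] by blast
  ultimately have "Idl (set xs) \<noteq> carrier R" using ne by blast
  moreover have "z \<in> Idl (set (take i xs))"
    if "i < length xs" "z \<in> carrier R" "xs ! i \<otimes> z \<in> Idl (set (take i xs))" for i z
    using reg[of i z] that by (simp add: nth_append)
  ultimately show "regular_sequence R xs" using c unfolding regular_sequence_iff by simp
qed

text \<open>A prime that avoids all products \<open>x\<^sup>n s\<close> with \<open>s \<notin> Q\<close> lies inside \<open>Q\<close> (take \<open>n = 0\<close>) and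
  misses \<open>x\<close> (take \<open>n = s = 1\<close>). No such product lies in \<open>I\<close>, because \<open>x\<close> is regular modulo \<open>I\<close>
  and so \<open>s\<close> would lie in \<open>I \<subseteq> Q\<close>. This gives a strictly smaller prime without the theory of
  minimal or associated primes.\<close>

lemma (in cring) exists_smaller_prime:
  assumes I: "ideal I R" and Q: "primeideal Q R" "I \<subseteq> Q" "x \<in> Q"
    and reg: "\<And>z. z \<in> carrier R \<Longrightarrow> x \<otimes> z \<in> I \<Longrightarrow> z \<in> I"
  obtains P where "primeideal P R" "I \<subseteq> P" "P \<subset> Q"
proof -
  interpret Q: primeideal Q R by (rule Q(1))
  have x: "x \<in> carrier R" using Q(3) by (rule Q.Icarr)
  define S where "S = {x [^] n \<otimes> s |(n::nat) s. s \<in> carrier R - Q}"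
  have one: "\<one> \<in> carrier R - Q" using Q.one_imp_carrier Q.I_notcarr by auto
  have pow: "z \<in> I" if "x [^] n \<otimes> z \<in> I" "z \<in> carrier R" for z and n :: nat
    using that
  proof (induction n arbitrary: z)
    case (Suc n)
    then have "x [^] n \<otimes> (x \<otimes> z) \<in> I" using x by (simp add: m_assoc)
    then have "x \<otimes> z \<in> I" using Suc.IH[of "x \<otimes> z"] Suc.prems(2) x by simp
    then show ?case using reg Suc.prems(2) by blast
  qed simp
  obtain P where P: "primeideal P R" "I \<subseteq> P" "P \<inter> S = {}"
  proof (rule exists_prime_disjoint[OF I, of S])
    show "S \<subseteq> carrier R" using x by (auto simp: S_def)
    show "S \<noteq> {}" using one by (auto simp: S_def)
    have False if "a \<in> I" "a \<in> S" for a
    proof -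
      obtain n :: nat and s where "a = x [^] n \<otimes> s" "s \<in> carrier R - Q"
        using \<open>a \<in> S\<close> unfolding S_def by blast
      then show False using pow[of n s] \<open>a \<in> I\<close> Q(2) by blast
    qed
    then show "I \<inter> S = {}" by blast
    show "a \<otimes> b \<in> S" if "a \<in> S" "b \<in> S" for a b
    proof -
      obtain m :: nat and s where a: "a = x [^] m \<otimes> s" "s \<in> carrier R - Q"
        using \<open>a \<in> S\<close> unfolding S_def by blast
      obtain n :: nat and t where b: "b = x [^] n \<otimes> t" "t \<in> carrier R - Q"
        using \<open>b \<in> S\<close> unfolding S_def by blast
      have "a \<otimes> b = x [^] m \<otimes> x [^] n \<otimes> (s \<otimes> t)"
        unfolding a b using a(2) b(2) x by (simp add: m_ac)
      also have "x [^] m \<otimes> x [^] n = x [^] (m + n)" using x by (simp add: nat_pow_mult)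
      finally have "a \<otimes> b = x [^] (m + n) \<otimes> (s \<otimes> t)" .
      moreover have "s \<otimes> t \<in> carrier R - Q" using a(2) b(2) Q.I_prime[of s t] by auto
      ultimately show ?thesis unfolding S_def by blast
    qed
  qed
  have "s \<in> S" if "s \<in> carrier R - Q" for s
  proof -
    have "x [^] (0::nat) \<otimes> s \<in> S" using that unfolding S_def by blast
    then show ?thesis using that by simp
  qed
  then have "P \<subseteq> Q" using P(3) ideal.Icarr[OF primeideal.axioms(1)[OF P(1)]] by blast
  moreover have "x [^] (1::nat) \<otimes> \<one> \<in> S" using one unfolding S_def by blast
  then have "x \<in> S" using x by simp
  then have "x \<notin> P" using P(3) by blast
  ultimately show thesis using that P(1,2) Q(3) by blast
qed

definition prime_chain :: "('a, 'b) ring_scheme \<Rightarrow> nat \<Rightarrow> (nat \<Rightarrow> 'a set) \<Rightarrow> bool" where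
  "prime_chain R n P \<longleftrightarrow> (\<forall>i\<le>n. primeideal (P i) R) \<and> (\<forall>i<n. P i \<subset> P (Suc i))"

lemma prime_chain_extend:
  assumes P: "prime_chain R n P" and Q: "P n \<subset> Q" "primeideal Q R"
  shows "prime_chain R (Suc n) (P(Suc n := Q))"
  unfolding prime_chain_def
proof (intro conjI allI impI)
  fix i
  show "primeideal ((P(Suc n := Q)) i) R" if "i \<le> Suc n"
    using that P Q(2) by (simp add: prime_chain_def)
  show "(P(Suc n := Q)) i \<subset> (P(Suc n := Q)) (Suc i)" if "i < Suc n"
    using that P Q(1) by (cases "i = n") (simp_all add: prime_chain_def)
qed

lemma le_krull_dim:
  assumes "prime_chain R n P"
  shows "enat n \<le> krull_dim R"
  unfolding krull_dim_def by (rule Sup_upper) (use assms in \<open>auto simp: prime_chain_def\<close>)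

lemma krull_dim_le:
  assumes "\<And>n P. prime_chain R n P \<Longrightarrow> enat n \<le> d"
  shows "krull_dim R \<le> d"
  unfolding krull_dim_def by (rule Sup_least) (use assms in \<open>auto simp: prime_chain_def\<close>)

text \<open>The chain is built downwards from \<open>Q\<close>: the last element of the sequence is regular modulo the
  ideal of the others, hence \<open>Q\<close> can be shrunk to a prime that still contains the others.\<close>

lemma (in cring) regular_sequence_prime_chain:
  assumes "regular_sequence R xs" "primeideal Q R" "set xs \<subseteq> Q"
  shows "\<exists>P. prime_chain R (length xs) P \<and> P (length xs) = Q"
  using assms
proof (induction xs arbitrary: Q rule: rev_induct)
  case Nil
  then show ?case by (intro exI[of _ "\<lambda>_. Q"]) (simp add: prime_chain_def)
next
  case (snoc x xs)
  note xs = regular_sequence_snocD[OF snoc.prems(1)]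
  have c: "set xs \<subseteq> carrier R" using xs(1) by (simp add: regular_sequence_iff)
  have "Idl (set xs) \<subseteq> Q"
    using genideal_minimal[OF primeideal.axioms(1)[OF snoc.prems(2)]] snoc.prems(3) by simp
  moreover have "x \<in> Q" using snoc.prems(3) by simp
  ultimately obtain Q' where Q': "primeideal Q' R" "Idl (set xs) \<subseteq> Q'" "Q' \<subset> Q"
    using exists_smaller_prime[OF genideal_ideal[OF c] snoc.prems(2) _ _ xs(3)] by blast
  then have "set xs \<subseteq> Q'" using genideal_self[OF c] by blast
  then obtain P where P: "prime_chain R (length xs) P" "P (length xs) = Q'"
    using snoc.IH[OF xs(1) Q'(1)] by blast
  have "prime_chain R (Suc (length xs)) (P(Suc (length xs) := Q))"
    using prime_chain_extend[OF P(1)] P(2) Q'(3) snoc.prems(2) by blast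
  then show ?case by (intro exI[of _ "P(Suc (length xs) := Q)"]) (simp del: fun_upd_apply add: fun_upd_same)
qed

section \<open>Noetherian local rings\<close>

lemma (in noetherian_ring) exists_maximalideal_above:
  assumes "ideal I R" "I \<noteq> carrier R"
  shows "\<exists>M. maximalideal M R \<and> I \<subseteq> M"
  using assms
proof (induction I rule: noetherian_ideal_induct)
  case (step I)
  show ?case
  proof (cases "maximalideal I R")
    case False
    then obtain J where "ideal J R" "I \<subset> J" "J \<noteq> carrier R"
      using maximalidealI[OF step(1)] step.prems by blast
    then show ?thesis using step.IH by blast
  qed blast
qed

context noetherian_local_ring
begin

lemma maximalideal_max_ideal: "maximalideal (max_ideal R) R"
  unfolding max_ideal_def by (rule theI'[OF unique_maximal])

lemma max_ideal_unique: "maximalideal M R \<Longrightarrow> M = max_ideal R"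
  using unique_maximal maximalideal_max_ideal by blast

lemma primeideal_max_ideal: "primeideal (max_ideal R) R"
  by (rule maximalideal_prime[OF maximalideal_max_ideal])

end

lemma (in noetherian_local_ring) ideal_le_max_ideal:
  assumes "ideal I R" "I \<noteq> carrier R"
  shows "I \<subseteq> max_ideal R"
  using exists_maximalideal_above[OF assms] max_ideal_unique by blast

lemma length_le_depth:
  assumes "regular_sequence R xs" "set xs \<subseteq> max_ideal R"
  shows "enat (length xs) \<le> depth R"
  unfolding depth_def by (rule Sup_upper) (use assms in blast)

lemma exists_regular_pair:
  assumes "depth R = 2"
  obtains g h where "regular_sequence R [g, h]" "g \<in> max_ideal R" "h \<in> max_ideal R"
proof -
  have "\<exists>xs. regular_sequence R xs \<and> set xs \<subseteq> max_ideal R \<and> length xs \<ge> 2"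
  proof (rule ccontr)
    assume "\<nexists>xs. regular_sequence R xs \<and> set xs \<subseteq> max_ideal R \<and> length xs \<ge> 2"
    then have "length xs \<le> 1" if "regular_sequence R xs" "set xs \<subseteq> max_ideal R" for xs
      using that by force
    then have "depth R \<le> enat 1"
      unfolding depth_def by (intro Sup_least) auto
    then show False using assms by (simp add: numeral_eq_enat)
  qed
  then obtain xs where xs: "regular_sequence R xs" "set xs \<subseteq> max_ideal R" "length xs \<ge> 2" by blast
  have "length xs \<le> 2"
    using length_le_depth[OF xs(1,2)] assms by (simp add: numeral_eq_enat)
  then have "length xs = 2" using xs(3) by simp
  then obtain g h where "xs = [g, h]" by (auto simp: length_Suc_conv numeral_2_eq_2)
  then show thesis using that xs by simp
qed

lemma (in noetherian_local_ring) depth_le_krull_dim: "depth R \<le> krull_dim R"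
  unfolding depth_def
proof (rule Sup_least, clarify)
  fix xs assume "regular_sequence R xs" "set xs \<subseteq> max_ideal R"
  then show "enat (length xs) \<le> krull_dim R"
    using regular_sequence_prime_chain[OF _ primeideal_max_ideal] le_krull_dim by blast
qed

text \<open>A regular sequence of length \<open>dim R\<close> generates an ideal primary to the maximal ideal: below
  another prime \<open>P\<close> containing it there would be a chain of length \<open>dim R\<close>, which the maximal ideal
  would extend.\<close>

lemma (in noetherian_local_ring) prime_above_full_regular_sequence:
  assumes xs: "regular_sequence R xs" "krull_dim R = enat (length xs)"
    and P: "primeideal P R" "set xs \<subseteq> P"
  shows "P = max_ideal R"
proof (rule ccontr)
  assume "P \<noteq> max_ideal R"
  then have "P \<subset> max_ideal R"
    using ideal_le_max_ideal[of P] P(1) primeideal.axioms(1) primeideal.I_notcarr by blast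
  moreover obtain C where "prime_chain R (length xs) C" "C (length xs) = P"
    using regular_sequence_prime_chain[OF xs(1) P] by blast
  ultimately have "enat (Suc (length xs)) \<le> krull_dim R"
    using le_krull_dim[OF prime_chain_extend] primeideal_max_ideal by blast
  then show False using xs(2) by simp
qed

section \<open>Homomorphic images\<close>

context ring_hom_ring
begin

text \<open>Chains of ideals of \<open>S\<close> pull back to chains in \<open>R\<close>, which have a largest member; by
  surjectivity an ideal of \<open>S\<close> can be recovered from its preimage.\<close>

lemma noetherian_image:
  assumes noeth: "noetherian_ring R" and surj: "h ` carrier R = carrier S"
  shows "noetherian_ring S"
proof (rule S.trivial_ideal_chain_imp_noetherian)
  fix C assume C: "C \<noteq> {}" "subset.chain {I. ideal I S} C"
  define f where "f J = {r \<in> carrier R. h r \<in> J}" for J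
  have "f J \<in> {I. ideal I R}" if "J \<in> C" for J
    using that C(2) ideal_vimage unfolding pred_on.chain_def f_def by blast
  moreover have "f J \<subseteq> f K \<or> f K \<subseteq> f J" if "J \<in> C" "K \<in> C" for J K
  proof -
    have "J \<subseteq> K \<or> K \<subseteq> J" using that C(2) unfolding pred_on.chain_def by blast
    then show ?thesis unfolding f_def by blast
  qed
  ultimately have "subset.chain {I. ideal I R} (f ` C)"
    unfolding pred_on.chain_def by blast
  then have "\<Union>(f ` C) \<in> f ` C"
    using noetherian_ring.ideal_chain_is_trivial[OF noeth, of "f ` C"] C(1) by simp
  then obtain J where J: "J \<in> C" "\<Union>(f ` C) = f J" by (rule imageE)
  have "K \<subseteq> J" if K: "K \<in> C" for K
  proof
    fix y assume y: "y \<in> K"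
    have "ideal K S" using K C(2) unfolding pred_on.chain_def by blast
    then have "y \<in> h ` carrier R" using ideal.Icarr y surj by metis
    then obtain r where r: "r \<in> carrier R" "y = h r" by blast
    then have "r \<in> f K" using y by (simp add: f_def)
    then have "r \<in> f J" using J(2) K by blast
    then show "y \<in> J" using r(2) by (simp add: f_def)
  qed
  then have "\<Union>C = J" using J(1) by blast
  then show "\<Union>C \<in> C" using J(1) by simp
qed

text \<open>An ideal \<open>J\<close> above the preimage of \<open>M\<close> contains the kernel, so it is determined by its image,
  which is \<open>M\<close> or everything.\<close>

lemma maximalideal_vimage:
  assumes M: "maximalideal M S" and surj: "h ` carrier R = carrier S"
  shows "maximalideal {r \<in> carrier R. h r \<in> M} R"
proof (rule maximalidealI)
  interpret M: maximalideal M S by (rule M)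
  show "ideal {r \<in> carrier R. h r \<in> M} R" by (rule ideal_vimage[OF M.is_ideal])
  show "carrier R \<noteq> {r \<in> carrier R. h r \<in> M}"
  proof
    assume "carrier R = {r \<in> carrier R. h r \<in> M}"
    then have "h ` carrier R \<subseteq> M" by blast
    then show False using M.I_notcarr M.a_subset surj by simp
  qed
  fix J assume J: "ideal J R" "{r \<in> carrier R. h r \<in> M} \<subseteq> J" "J \<subseteq> carrier R"
  interpret J: ideal J R by (rule J(1))
  have saturated: "r \<in> J" if r: "r \<in> carrier R" "s \<in> J" "h r = h s" for r s
  proof -
    have s: "s \<in> carrier R" using r(2) by (rule J.Icarr)
    have "h (r \<ominus> s) = \<zero>\<^bsub>S\<^esub>" using r s by (simp add: a_minus_def S.r_neg)
    then have "r \<ominus> s \<in> {r \<in> carrier R. h r \<in> M}" using r(1) s by simp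
    then have "r \<ominus> s \<in> J" using J(2) by blast
    then have "(r \<ominus> s) \<oplus> s \<in> J" using r(2) by (rule J.a_closed)
    then show ?thesis using r(1) s by (simp add: a_minus_def R.a_assoc R.l_neg)
  qed
  have "ideal (h ` J) S"
  proof (rule idealI[OF S.ring_axioms])
    show "subgroup (h ` J) (add_monoid S)" by (rule img_is_add_subgroup[OF J.a_subgroup])
    show "x \<otimes>\<^bsub>S\<^esub> a \<in> h ` J" "a \<otimes>\<^bsub>S\<^esub> x \<in> h ` J" if a: "a \<in> h ` J" and x: "x \<in> carrier S" for a x
    proof -
      obtain j where j: "a = h j" "j \<in> J" using a by (rule imageE)
      have "x \<in> h ` carrier R" using x unfolding surj .
      then obtain r where r: "x = h r" "r \<in> carrier R" by (rule imageE)
      have "j \<in> carrier R" using j(2) by (rule J.Icarr)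
      then have "h (r \<otimes> j) = x \<otimes>\<^bsub>S\<^esub> a" "h (j \<otimes> r) = a \<otimes>\<^bsub>S\<^esub> x"
        unfolding j(1) r(1) using r(2) by simp_all
      moreover have "h (r \<otimes> j) \<in> h ` J" "h (j \<otimes> r) \<in> h ` J"
        using J.I_l_closed[OF j(2) r(2)] J.I_r_closed[OF j(2) r(2)] by simp_all
      ultimately show "x \<otimes>\<^bsub>S\<^esub> a \<in> h ` J" "a \<otimes>\<^bsub>S\<^esub> x \<in> h ` J" by simp_all
    qed
  qed
  moreover have "M \<subseteq> h ` carrier R" using M.a_subset unfolding surj .
  then have "M \<subseteq> h ` J" using J(2) by blast
  moreover have "h ` J \<subseteq> carrier S" using J(3) unfolding surj[symmetric] by blast
  ultimately have "h ` J = M \<or> h ` J = carrier S" by (rule M.I_maximal)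
  then show "J = {r \<in> carrier R. h r \<in> M} \<or> J = carrier R"
  proof
    assume "h ` J = M"
    then show ?thesis using J(2,3) by blast
  next
    assume "h ` J = carrier S"
    then have "h r \<in> h ` J" if "r \<in> carrier R" for r using that by simp
    then have "carrier R \<subseteq> J" using saturated by blast
    then show ?thesis using J(3) by blast
  qed
qed

lemma krull_dim_image_le:
  assumes R: "cring R" and surj: "h ` carrier R = carrier S"
  shows "krull_dim S \<le> krull_dim R"
proof (rule krull_dim_le)
  fix n P assume P: "prime_chain S n P"
  have "prime_chain R n (\<lambda>i. {r \<in> carrier R. h r \<in> P i})"
    unfolding prime_chain_def
  proof (intro conjI allI impI)
    show "primeideal {r \<in> carrier R. h r \<in> P i} R" if "i \<le> n" for i
      by (rule primeideal_vimage[OF R]) (use P that in \<open>simp add: prime_chain_def\<close>)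
    fix i assume i: "i < n"
    then interpret P: primeideal "P (Suc i)" S using P by (simp add: prime_chain_def)
    have "P (Suc i) \<subseteq> h ` carrier R" using P.a_subset unfolding surj .
    moreover have "P i \<subset> P (Suc i)" using P i by (simp add: prime_chain_def)
    ultimately show "{r \<in> carrier R. h r \<in> P i} \<subset> {r \<in> carrier R. h r \<in> P (Suc i)}" by blast
  qed
  then show "enat n \<le> krull_dim R" by (rule le_krull_dim)
qed

lemma noetherian_local_image:
  assumes R: "noetherian_local_ring R" and S: "cring S" "\<one>\<^bsub>S\<^esub> \<noteq> \<zero>\<^bsub>S\<^esub>"
    and surj: "h ` carrier R = carrier S"
  shows "noetherian_local_ring S"
    and "max_ideal R = {r \<in> carrier R. h r \<in> max_ideal S}"
proof -
  interpret L: noetherian_local_ring R by (rule R)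
  have noeth: "noetherian_ring S" by (rule noetherian_image[OF L.noetherian_ring_axioms surj])
  have vim: "{r \<in> carrier R. h r \<in> M} = max_ideal R" if "maximalideal M S" for M
    by (rule L.max_ideal_unique[OF maximalideal_vimage[OF that surj]])
  have image: "M = h ` max_ideal R" if "maximalideal M S" for M
  proof -
    interpret M: maximalideal M S by (rule that)
    have "M \<subseteq> h ` carrier R" using M.a_subset unfolding surj .
    then show ?thesis unfolding vim[OF that, symmetric] by blast
  qed
  have "{\<zero>\<^bsub>S\<^esub>} \<noteq> carrier S" using S(2) S.one_closed by blast
  then obtain M where "maximalideal M S"
    using noetherian_ring.exists_maximalideal_above[OF noeth S.zeroideal] by blast
  then have "\<exists>!M. maximalideal M S" using image by metis
  then show loc: "noetherian_local_ring S"
    by (intro noetherian_local_ring.intro S(1) noeth noetherian_local_ring_axioms.intro)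
  show "max_ideal R = {r \<in> carrier R. h r \<in> max_ideal S}"
    using vim[OF noetherian_local_ring.maximalideal_max_ideal[OF loc]] by simp
qed

end

section \<open>Descent of a regular sequence to the reduced ring\<close>

lemma (in cring) regular_element_mod_nilradical:
  assumes g: "regular_element R g" and z: "z \<in> carrier R" and gz: "g \<otimes> z \<in> nilradical R"
  shows "z \<in> nilradical R"
proof -
  have gc: "g \<in> carrier R" using g by (simp add: regular_element_def)
  obtain n :: nat where "(g \<otimes> z) [^] n = \<zero>" using gz by (auto simp: nilradical_def)
  then have "g [^] n \<otimes> z [^] n = \<zero>" using gc z by (simp add: nat_pow_distrib)
  moreover have "w = \<zero>" if "g [^] k \<otimes> w = \<zero>" "w \<in> carrier R" for k :: nat and w
    using that
  proof (induction k arbitrary: w)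
    case (Suc k)
    then have "g [^] k \<otimes> (g \<otimes> w) = \<zero>" using gc by (simp add: m_assoc)
    then have "g \<otimes> w = \<zero>" using Suc.IH[of "g \<otimes> w"] Suc.prems(2) gc by simp
    then show ?case using g Suc.prems(2) by (simp add: regular_element_def)
  qed simp
  ultimately have "z [^] n = \<zero>" using z by blast
  then show ?thesis using z by (auto simp: nilradical_def)
qed

text \<open>The elements \<open>j\<close> with \<open>zj \<in> K\<close> form an ideal that contains \<open>g\<close> and \<open>h\<close>, hence also a power of
  the maximal ideal. So \<open>z\<close> is in the saturation of \<open>K\<close>.\<close>

lemma (in noetherian_local_ring) regular_mod_saturated:
  assumes gh: "regular_sequence R [g, h]" and dim: "krull_dim R = 2"
    and K: "ideal K R" "saturation R K = K" "g \<in> K"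
    and z: "z \<in> carrier R" "h \<otimes> z \<in> K"
  shows "z \<in> K"
proof -
  interpret K: ideal K R by (rule K(1))
  have c: "g \<in> carrier R" "h \<in> carrier R" using gh by (auto simp: regular_sequence_def)
  have m: "ideal (max_ideal R) R" using primeideal_max_ideal by (rule primeideal.axioms(1))
  have gen: "ideal (Idl {g, h}) R" using c by (intro genideal_ideal) simp
  have "max_ideal R \<subseteq> P" if "primeideal P R" "Idl {g, h} \<subseteq> P" for P
    using prime_above_full_regular_sequence[OF gh _ that(1)] that(2) genideal_self[of "{g, h}"] c dim
    by (auto simp: numeral_eq_enat)
  then obtain k :: nat where k: "k \<ge> 1" "max_ideal R [^]\<^bsub>ideals_set R\<^esub> k \<subseteq> Idl {g, h}"
    using ideal_power_le_ideal[OF is_cring noetherian_ring_axioms m gen] by blast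
  have "ideal {j \<in> carrier R. z \<otimes> j \<in> K} R"
  proof (rule idealI[OF ring_axioms])
    show "subgroup {j \<in> carrier R. z \<otimes> j \<in> K} (add_monoid R)"
      by (rule subgroup.intro) (use z in \<open>auto simp: r_distr r_minus simp flip: a_inv_def\<close>)
    fix j x assume jx: "j \<in> {j \<in> carrier R. z \<otimes> j \<in> K}" "x \<in> carrier R"
    then have "z \<otimes> (x \<otimes> j) = x \<otimes> (z \<otimes> j)" "z \<otimes> (j \<otimes> x) = (z \<otimes> j) \<otimes> x"
      using z(1) by (simp_all add: m_lcomm m_assoc)
    then show "x \<otimes> j \<in> {j \<in> carrier R. z \<otimes> j \<in> K}" "j \<otimes> x \<in> {j \<in> carrier R. z \<otimes> j \<in> K}"
      using jx by (simp_all add: K.I_l_closed K.I_r_closed)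
  qed
  moreover have "{g, h} \<subseteq> {j \<in> carrier R. z \<otimes> j \<in> K}"
    using c z K(3) K.I_l_closed by (auto simp: m_comm)
  ultimately have "Idl {g, h} \<subseteq> {j \<in> carrier R. z \<otimes> j \<in> K}" by (rule genideal_minimal)
  then have "z \<in> colon_ideal R K (max_ideal R [^]\<^bsub>ideals_set R\<^esub> k)"
    using k(2) z(1) by (auto simp: colon_ideal_def)
  then have "z \<in> saturation R K" using k(1) by (auto simp: saturation_def)
  then show ?thesis using K(2) by simp
qed

theorem proposition6p2:
  fixes R :: "('a, 'b) ring_scheme"
  assumes "cohen_macaulay_local_ring R"
    and "krull_dim R = 2"
    and "\<And>g. g \<in> carrier R \<Longrightarrow> regular_element R g \<Longrightarrow>
           saturation R (PIdl\<^bsub>R\<^esub> g <+>\<^bsub>R\<^esub> nilradical R) = PIdl\<^bsub>R\<^esub> g <+>\<^bsub>R\<^esub> nilradical R"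
  shows "cohen_macaulay_local_ring (R Quot nilradical R)"
proof -
  interpret cohen_macaulay_local_ring R by (rule assms(1))
  let ?N = "nilradical R" and ?S = "R Quot nilradical R"
  let ?\<pi> = "(+>\<^bsub>R\<^esub>) ?N"
  interpret N: ideal ?N R by (rule ideal_nilradical)
  interpret \<pi>: ring_hom_ring R ?S ?\<pi> by (rule N.rcos_ring_hom_ring)
  interpret S: cring ?S by (rule N.quotient_is_cring[OF is_cring])
  have surj: "?\<pi> ` carrier R = carrier ?S" by (rule carrier_Quot[symmetric])
  have zero: "\<zero>\<^bsub>?S\<^esub> = ?N" by (rule zero_Quot)
  interpret m: primeideal "max_ideal R" R by (rule primeideal_max_ideal)
  have "\<one>\<^bsub>R\<^esub> \<notin> max_ideal R" using m.one_imp_carrier m.I_notcarr by auto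
  then have "\<one>\<^bsub>R\<^esub> \<notin> ?N" using m.primeideal by (auto simp: mem_nilradical_iff)
  then have "\<one>\<^bsub>?S\<^esub> \<noteq> \<zero>\<^bsub>?S\<^esub>"
    using rcos_eq_ideal_iff[OF N.is_ideal one_closed] unfolding zero \<pi>.hom_one[symmetric] by blast
  note local = \<pi>.noetherian_local_image[OF noetherian_local_ring_axioms S.is_cring this surj]
  interpret L: noetherian_local_ring ?S by (rule local(1))
  have "depth R = 2" using depth_eq_dim assms(2) by simp
  then obtain g h where gh: "regular_sequence R [g, h]" "g \<in> max_ideal R" "h \<in> max_ideal R"
    by (rule exists_regular_pair)
  have c: "g \<in> carrier R" "h \<in> carrier R" and g: "regular_element R g"
    using gh(1) by (auto simp: regular_sequence_pair_iff regular_element_def)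
  define K where "K = PIdl\<^bsub>R\<^esub> g <+>\<^bsub>R\<^esub> ?N"
  have K_eq: "K = ?N <+>\<^bsub>R\<^esub> PIdl\<^bsub>R\<^esub> g"
    unfolding K_def
    by (rule set_add_comm[OF additive_subgroup.a_subset[OF ideal.axioms(1)[OF cgenideal_ideal[OF c(1)]]]
          N.a_subset])
  interpret K: ideal K R unfolding K_eq by (rule adjoin_element(1)[OF N.is_ideal c(1)])
  have gK: "g \<in> K" and NK: "?N \<subseteq> K"
    unfolding K_eq using adjoin_element(2,3)[OF N.is_ideal c(1)] by blast+
  have satK: "saturation R K = K" unfolding K_def by (rule assms(3)[OF c(1) g])
  \<comment> \<open>Regularity of the image of \<open>h\<close> modulo the image of \<open>g\<close> becomes a statement about \<open>K\<close> in \<open>R\<close>.\<close>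
  have memK: "?\<pi> z \<in> PIdl\<^bsub>?S\<^esub> (?\<pi> g) \<longleftrightarrow> z \<in> K" if z: "z \<in> carrier R" for z
  proof
    assume "?\<pi> z \<in> PIdl\<^bsub>?S\<^esub> (?\<pi> g)"
    then obtain x where x: "x \<in> carrier R" "?\<pi> z = ?\<pi> x \<otimes>\<^bsub>?S\<^esub> ?\<pi> g"
      unfolding cgenideal_def surj[symmetric] by blast
    then have "?\<pi> z = ?\<pi> (x \<otimes>\<^bsub>R\<^esub> g)" using c by simp
    then have "z \<ominus>\<^bsub>R\<^esub> x \<otimes>\<^bsub>R\<^esub> g \<in> ?N"
      using quotient_eq_iff_same_a_r_cos[OF N.is_ideal z, of "x \<otimes>\<^bsub>R\<^esub> g"] x(1) c by simp
    moreover have "x \<otimes>\<^bsub>R\<^esub> g \<in> K" using gK x(1) by (rule K.I_l_closed)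
    ultimately have "(z \<ominus>\<^bsub>R\<^esub> x \<otimes>\<^bsub>R\<^esub> g) \<oplus>\<^bsub>R\<^esub> x \<otimes>\<^bsub>R\<^esub> g \<in> K"
      using NK by (intro K.a_closed) blast+
    then show "z \<in> K" using z x(1) c by (simp add: a_minus_def a_assoc l_neg)
  next
    assume "z \<in> K"
    then obtain x n where xn: "x \<in> carrier R" "n \<in> ?N" "z = x \<otimes>\<^bsub>R\<^esub> g \<oplus>\<^bsub>R\<^esub> n"
      unfolding K_def by (auto simp: set_add_def' cgenideal_def)
    have "?\<pi> n = \<zero>\<^bsub>?S\<^esub>" using a_rcos_zero[OF N.is_ideal xn(2)] zero by simp
    then have "?\<pi> z = ?\<pi> x \<otimes>\<^bsub>?S\<^esub> ?\<pi> g" using xn c N.Icarr by simp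
    then show "?\<pi> z \<in> PIdl\<^bsub>?S\<^esub> (?\<pi> g)" using xn(1) unfolding cgenideal_def by auto
  qed
  have "regular_sequence ?S [?\<pi> g, ?\<pi> h]"
    unfolding S.regular_sequence_pair_iff
  proof (intro conjI ballI impI)
    show "?\<pi> h \<in> carrier ?S" using c by simp
    have "regular_element (R Quot ?N) (?N +>\<^bsub>R\<^esub> g)"
      using regular_element_Quot_iff[OF N.is_ideal c(1)] regular_element_mod_nilradical[OF g] by blast
    then show "regular_element ?S (?\<pi> g)" .
    fix w assume "w \<in> carrier ?S" and hw: "?\<pi> h \<otimes>\<^bsub>?S\<^esub> w \<in> PIdl\<^bsub>?S\<^esub> (?\<pi> g)"
    then obtain z where z: "z \<in> carrier R" "w = ?\<pi> z" using surj by blast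
    then have "h \<otimes>\<^bsub>R\<^esub> z \<in> K" using hw memK[of "h \<otimes>\<^bsub>R\<^esub> z"] c by simp
    then have "z \<in> K"
      using regular_mod_saturated[OF gh(1) assms(2) K.is_ideal satK gK z(1)] by blast
    then show "w \<in> PIdl\<^bsub>?S\<^esub> (?\<pi> g)" using memK z by simp
  next
    have m: "ideal (max_ideal ?S) ?S" using L.primeideal_max_ideal by (rule primeideal.axioms(1))
    have "Idl\<^bsub>?S\<^esub> {?\<pi> g, ?\<pi> h} \<subseteq> max_ideal ?S"
      using gh(2,3) unfolding local(2) by (intro ring.genideal_minimal[OF N.quotient_is_ring m]) auto
    then show "Idl\<^bsub>?S\<^esub> {?\<pi> g, ?\<pi> h} \<noteq> carrier ?S"
      using ideal.Icarr[OF m] primeideal.I_notcarr[OF L.primeideal_max_ideal] by blast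
  qed
  moreover have "set [?\<pi> g, ?\<pi> h] \<subseteq> max_ideal ?S" using gh(2,3) unfolding local(2) by auto
  ultimately have "enat (length [?\<pi> g, ?\<pi> h]) \<le> depth ?S" by (rule length_le_depth)
  then have "2 \<le> depth ?S" by (simp add: numeral_eq_enat numeral_2_eq_2)
  moreover have "krull_dim ?S \<le> 2" using \<pi>.krull_dim_image_le[OF is_cring surj] assms(2) by simp
  ultimately have "depth ?S = krull_dim ?S" using L.depth_le_krull_dim by (metis order_antisym order_trans)
  then show ?thesis
    by (intro cohen_macaulay_local_ring.intro local(1) cohen_macaulay_local_ring_axioms.intro)
qed

end
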